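(* Let $\Omega_0=\bigcup_{i=1}^{\infty} I_i\subset\mathbb{R}$ be a bounded open set, where the $I_i=(\alpha_i,\beta_i)$ are pairwise disjoint open intervals. Let $\rho$ and $v$ be the solution, for $0\le t<1$, of the one-dimensional aggregation equation $$\rho_t+(\rho v)_x=0,\qquad v(\cdot,t)=-N_x*\rho(\cdot,t),\qquad \rho(\cdot,0)=\chi_{\Omega_0},\qquad N(x)=\tfrac12|x|,$$ with flow map $X$, and let $\Omega_1=\lim_{t\to1^-}X(\Omega_0,t)$ be its skeleton. Then there are points $x_i\in\mathbb{R}$, $i\ge 1$, where $x_i$ is the common value of $\lim_{t\to1^-}X(\alpha,t)$ for $\alpha\in I_i$, such that $$\Omega_1=\bigcup_{i=1}^{\infty}\{x_i\},$$ and, if $\mathrm{d}\mu_t=\rho(\cdot,t)\,\mathrm{d}x$ for $0\le t<1$, then $\mu_t$ converges weakly as $t\to1^-$ to $$\mu_1=\sum_{i=1}^{\infty}|I_i|\,\delta_{x_i},$$ where $\delta_{x_i}$ is the Dirac measure at $x_i$.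
   Context: $|A|$ denotes the Lebesgue measure of $A\subset\mathbb{R}$ and $\chi_A$ its characteristic function. Here $N_x(x)=\frac12\operatorname{sign}(x)$, so that $v(x,t)=\frac12\int_x^{\infty}\rho(y,t)\,\mathrm{d}y-\frac12\int_{-\infty}^x\rho(y,t)\,\mathrm{d}y$. The flow map $X(\cdot,t)$ of $v$ is defined by $\frac{\mathrm{d}}{\mathrm{d}t}X(\alpha,t)=v(X(\alpha,t),t)$, $X(\alpha,0)=\alpha$; for $0\le t<1$ it is a homeomorphism of $\mathbb{R}$. The solution $\rho$ of the equation with bounded compactly supported initial datum $\rho_0$ is the one given along the flow map by $\rho(X(\alpha,t),t)=\frac{\rho_0(\alpha)}{1-t\rho_0(\alpha)}$; for $\rho_0=\chi_{\Omega_0}$ this reads $\rho(\cdot,t)=\frac{1}{1-t}\chi_{\Omega_t}$ with $\Omega_t=X(\Omega_0,t)$, $0\le t<1$. The skeleton (blow-up set) is $\Omega_1=\lim_{t\to1^-}X(\Omega_0,t)$, meaning the set of pointwise limits $\{\lim_{t\to1^-}X(\alpha,t):\alpha\in\Omega_0\}$. The points $x_i$ are not required to be distinct. Weak convergence $\mu_t\to\mu_1$ means $\int f\,\mathrm{d}\mu_t\to\int f\,\mathrm{d}\mu_1$ for every continuous function $f$ on $\mathbb{R}$. *)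

theory Defs
  imports "HOL-Probability.Probability"
begin

text \<open>Throughout, functions of space and time take the space variable first: \<open>\<rho> x t\<close>, \<open>v x t\<close>,
  and \<open>X a t\<close> is the position at time \<open>t\<close> of the particle that starts at \<open>a\<close>.\<close>

text \<open>The derivative \<open>N\<^sub>x\<close> of the one-dimensional Newtonian potential \<open>N x = \<bar>x\<bar> / 2\<close>,
  with value \<open>0\<close> at the origin.\<close>

definition newton_deriv :: "real \<Rightarrow> real" where
  "newton_deriv x = sgn x / 2"

definition aggregation_velocity :: "(real \<Rightarrow> real \<Rightarrow> real) \<Rightarrow> real \<Rightarrow> real \<Rightarrow> real" where
  "aggregation_velocity \<rho> x t = - (LINT y|lborel. newton_deriv (x - y) * \<rho> y t)"

text \<open>At \<open>t = 0\<close> the time derivative is one-sided.\<close>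

definition flow_map :: "real \<Rightarrow> (real \<Rightarrow> real \<Rightarrow> real) \<Rightarrow> (real \<Rightarrow> real \<Rightarrow> real) \<Rightarrow> bool" where
  "flow_map T v X \<longleftrightarrow>
     (\<forall>a. X a 0 = a) \<and>
     (\<forall>a. \<forall>t\<in>{0..<T}. (X a has_real_derivative v (X a t) t) (at t within {0..<T})) \<and>
     (\<forall>t\<in>{0..<T}. \<exists>Y. homeomorphism UNIV UNIV (\<lambda>a. X a t) Y)"

text \<open>Solutions on \<open>[0, T)\<close> of \<open>\<rho>\<^sub>t + (\<rho> v)\<^sub>x = 0\<close>, \<open>v = - N\<^sub>x * \<rho>\<close>, \<open>\<rho>(\<cdot>, 0) = \<rho>\<^sub>0\<close>. As
  \<open>v\<^sub>x = - \<rho>\<close>, the density satisfies \<open>d/dt \<rho> = \<rho>\<^sup>2\<close> along the flow of \<open>v\<close>; for merely bounded data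
  the solution is the function defined by integrating this equation along the trajectories, which
  determines \<open>\<rho>(\<cdot>, t)\<close> everywhere because \<open>X(\<cdot>, t)\<close> is onto. Integrability makes the convolution
  meaningful. The horizon \<open>T\<close> should be at most \<open>1 / sup \<rho>\<^sub>0\<close>.\<close>

definition aggregation_solution ::
  "real \<Rightarrow> (real \<Rightarrow> real) \<Rightarrow> (real \<Rightarrow> real \<Rightarrow> real) \<Rightarrow> (real \<Rightarrow> real \<Rightarrow> real) \<Rightarrow>
   (real \<Rightarrow> real \<Rightarrow> real) \<Rightarrow> bool" where
  "aggregation_solution T \<rho>\<^sub>0 \<rho> v X \<longleftrightarrow>
     (\<forall>t\<in>{0..<T}. integrable lborel (\<lambda>x. \<rho> x t)) \<and>
     (\<forall>x. \<forall>t\<in>{0..<T}. v x t = aggregation_velocity \<rho> x t) \<and>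
     flow_map T v X \<and>
     (\<forall>a. \<forall>t\<in>{0..<T}. \<rho> (X a t) t = \<rho>\<^sub>0 a / (1 - t * \<rho>\<^sub>0 a))"

text \<open>The set of pointwise limits of \<open>X(a, t)\<close>, \<open>a \<in> \<Omega>\<close>, as \<open>t\<close> tends to \<open>T\<close> from below.\<close>

definition skeleton :: "real \<Rightarrow> (real \<Rightarrow> real \<Rightarrow> real) \<Rightarrow> real set \<Rightarrow> real set" where
  "skeleton T X \<Omega> = {x. \<exists>a\<in>\<Omega>. (X a \<longlongrightarrow> x) (at_left T)}"

definition dirac_sum :: "(nat \<Rightarrow> ennreal) \<Rightarrow> (nat \<Rightarrow> real) \<Rightarrow> real measure" where
  "dirac_sum w x =
     measure_of UNIV (sets borel) (\<lambda>A. \<Sum>i. w i * emeasure (return borel (x i)) A)"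

lemma sets_dirac_sum [simp, measurable_cong]: "sets (dirac_sum w x) = sets borel"
  unfolding dirac_sum_def
  by (metis sets.sets_measure_of_eq space_borel)

text \<open>The set function in the definition is countably additive, so it really is the measure.\<close>

lemma emeasure_dirac_sum:
  assumes "A \<in> sets borel"
  shows "emeasure (dirac_sum w x) A = (\<Sum>i. w i * emeasure (return borel (x i)) A)"
proof (rule emeasure_measure_of[OF dirac_sum_def])
  show "positive (sets (dirac_sum w x)) (\<lambda>A. \<Sum>i. w i * emeasure (return borel (x i)) A)"
    by (simp add: positive_def)
  show "countably_additive (sets (dirac_sum w x)) (\<lambda>A. \<Sum>i. w i * emeasure (return borel (x i)) A)"
  proof (rule countably_additiveI)
    fix B :: "nat \<Rightarrow> real set"
    assume B: "range B \<subseteq> sets (dirac_sum w x)" "disjoint_family B"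
    have "(\<Sum>n. \<Sum>i. w i * emeasure (return borel (x i)) (B n)) =
        (\<Sum>i. \<Sum>n. w i * emeasure (return borel (x i)) (B n))"
      using nn_integral_suminf[of "\<lambda>n i. w i * emeasure (return borel (x i)) (B n)" "count_space UNIV"]
      by (simp add: nn_integral_count_space_nat)
    also have "\<dots> = (\<Sum>i. w i * emeasure (return borel (x i)) (\<Union>n. B n))"
    proof -
      have "(\<Sum>n. emeasure (return borel (x i)) (B n)) = emeasure (return borel (x i)) (\<Union>n. B n)"
        for i
        using B by (intro suminf_emeasure) auto
      then show ?thesis
        by (simp only: ennreal_suminf_cmult)
    qed
    finally show "(\<Sum>n. \<Sum>i. w i * emeasure (return borel (x i)) (B n)) =
        (\<Sum>i. w i * emeasure (return borel (x i)) (\<Union>n. B n))" .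
  qed
qed (use assms in auto)

text \<open>Convergence against all continuous functions, not only the bounded ones. Integrability is
  required explicitly because the integral of a non-integrable function is \<open>0\<close> by convention.\<close>

definition weakly_converges ::
  "('a \<Rightarrow> real measure) \<Rightarrow> real measure \<Rightarrow> 'a filter \<Rightarrow> bool" where
  "weakly_converges M N F \<longleftrightarrow>
     (\<forall>f :: real \<Rightarrow> real. continuous_on UNIV f \<longrightarrow>
        eventually (\<lambda>t. integrable (M t) f) F \<and> integrable N f \<and>
        ((\<lambda>t. LINT x|M t. f x) \<longlongrightarrow> (LINT x|N. f x)) F)"

end

theory Submission
  imports Defs
begin

text \<open>
  In one dimension \<open>v x t\<close> is half the mass to the right of \<open>x\<close> minus half the mass to its left.
  Paths of the flow cannot cross, so once mass is known to be transported by the flow, a particle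
  always has the same mass on either side. Its velocity is then constant and it moves on a straight
  line.

  That mass is transported has to be derived, as the density is only prescribed pointwise along
  paths. It suffices that the flow contracts every interval inside \<open>\<Omega>\<^sub>0\<close> by the factor \<open>1 - t\<close>
  (\<open>X_contraction\<close>), since the density there is \<open>1 / (1 - t)\<close>. The length \<open>L\<close> of the
  image of such an interval satisfies \<open>L' = - L / (1 - t)\<close>, because by \<open>v\<^sub>x = - \<rho>\<close> the velocity
  difference of two particles is minus the mass between them, which is
  \<open>L / (1 - t)\<close>. Summing over the components, \<open>\<rho> \<cdot> dx\<close> at time \<open>t\<close> is the image of Lebesgue
  measure on \<open>\<Omega>\<^sub>0\<close> under \<open>X(\<cdot>, t)\<close> (\<open>density_\<rho>_eq_distr\<close>).

  Straight paths have limits at \<open>t = 1\<close>, and by contraction all particles of \<open>I\<^sub>i\<close> end at one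
  point \<open>x\<^sub>i\<close>. Hence \<open>\<mu>\<^sub>1\<close> is the image of the same fixed measure under the limit map
  (\<open>dirac_sum_eq_distr\<close>), and weak convergence becomes dominated convergence of
  \<open>a \<mapsto> f (X a t)\<close> on \<open>\<Omega>\<^sub>0\<close>.
\<close>

section \<open>The velocity field of an integrable density\<close>

lemma integrable_newton_deriv_mult:
  assumes "integrable lborel r"
  shows "integrable lborel (\<lambda>y. newton_deriv (x - y) * r y)"
proof (rule Bochner_Integration.integrable_bound[OF assms])
  show "(\<lambda>y. newton_deriv (x - y) * r y) \<in> borel_measurable lborel"
    using borel_measurable_integrable[OF assms] unfolding newton_deriv_def by measurable
  show "AE y in lborel. norm (newton_deriv (x - y) * r y) \<le> norm (r y)"
    by (rule AE_I2) (simp add: newton_deriv_def abs_mult sgn_if)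
qed

text \<open>This is the integrated form of \<open>v\<^sub>x = - \<rho>\<close>: the kernel \<open>N\<^sub>x (q - y) - N\<^sub>x (p - y)\<close> is the
  indicator of \<open>(p, q)\<close> off its endpoints.\<close>

lemma aggregation_velocity_diff:
  assumes r: "integrable lborel (\<lambda>y. \<rho> y t)" and pq: "p < q"
  shows "aggregation_velocity \<rho> q t - aggregation_velocity \<rho> p t
    = - (LINT y:{p<..<q}|lborel. \<rho> y t)"
proof -
  have "aggregation_velocity \<rho> q t - aggregation_velocity \<rho> p t
      = - (LINT y|lborel. newton_deriv (q - y) * \<rho> y t - newton_deriv (p - y) * \<rho> y t)"
    using integrable_newton_deriv_mult[OF r] by (simp add: aggregation_velocity_def)
  also have "(LINT y|lborel. newton_deriv (q - y) * \<rho> y t - newton_deriv (p - y) * \<rho> y t)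
      = (LINT y:{p<..<q}|lborel. \<rho> y t)"
    unfolding set_lebesgue_integral_def
  proof (rule integral_cong_AE)
    show "AE y in lborel. newton_deriv (q - y) * \<rho> y t - newton_deriv (p - y) * \<rho> y t
        = indicat_real {p<..<q} y *\<^sub>R \<rho> y t"
      using AE_lborel_singleton[of p] AE_lborel_singleton[of q]
    proof eventually_elim
      case (elim y)
      then show ?case
        using pq by (auto simp: newton_deriv_def indicator_def sgn_if)
    qed
  qed (use borel_measurable_integrable[OF r] in \<open>unfold newton_deriv_def, measurable\<close>)
  finally show ?thesis .
qed

section \<open>Particle paths\<close>

lemma eventually_before_blowup: "\<forall>\<^sub>F t in at_left (1::real). t \<in> {0..<1}"
  by (rule eventually_mono[OF eventually_at_left_real[of 0 1]]) auto

locale patch_solution =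
  fixes \<alpha> \<beta> :: "nat \<Rightarrow> real"
    and \<Omega>\<^sub>0 :: "real set"
    and \<rho> v X :: "real \<Rightarrow> real \<Rightarrow> real"
  assumes endpoints: "\<And>i. \<alpha> i < \<beta> i"
    and disjoint: "disjoint_family (\<lambda>i. {\<alpha> i<..<\<beta> i})"
    and \<Omega>\<^sub>0_eq: "\<Omega>\<^sub>0 = (\<Union>i. {\<alpha> i<..<\<beta> i})"
    and bounded_\<Omega>\<^sub>0: "bounded \<Omega>\<^sub>0"
    and solution: "aggregation_solution 1 (indicator \<Omega>\<^sub>0) \<rho> v X"
begin

lemma X_0 [simp]: "X a 0 = a"
  using solution by (simp add: aggregation_solution_def flow_map_def)

lemma X_deriv:
  "t \<in> {0..<1} \<Longrightarrow> (X a has_real_derivative v (X a t) t) (at t within {0..<1})"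
  using solution unfolding aggregation_solution_def flow_map_def by blast

lemma v_eq: "t \<in> {0..<1} \<Longrightarrow> v x t = aggregation_velocity \<rho> x t"
  using solution by (simp add: aggregation_solution_def)

lemma integrable_\<rho>: "t \<in> {0..<1} \<Longrightarrow> integrable lborel (\<lambda>x. \<rho> x t)"
  using solution by (simp add: aggregation_solution_def)

lemma X_homeomorphism:
  assumes "t \<in> {0..<1}"
  obtains Y where "homeomorphism UNIV UNIV (\<lambda>a. X a t) Y"
  using solution assms unfolding aggregation_solution_def flow_map_def by blast

lemma continuous_X: "t \<in> {0..<1} \<Longrightarrow> continuous_on UNIV (\<lambda>a. X a t)"
  by (metis X_homeomorphism homeomorphism_cont1)

lemma measurable_X: "t \<in> {0..<1} \<Longrightarrow> (\<lambda>a. X a t) \<in> borel_measurable borel"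
  by (intro borel_measurable_continuous_onI continuous_X)

lemma surj_X: "t \<in> {0..<1} \<Longrightarrow> \<exists>a. y = X a t"
  by (metis X_homeomorphism homeomorphism_apply2 UNIV_I)

lemma inj_X: "t \<in> {0..<1} \<Longrightarrow> X a t = X b t \<Longrightarrow> a = b"
  by (metis X_homeomorphism homeomorphism_apply1 UNIV_I)

text \<open>Paths cannot cross: by continuity in time two crossing paths would meet, against injectivity.\<close>

lemma X_less:
  assumes t: "t \<in> {0..<1}" and ab: "a < b"
  shows "X a t < X b t"
proof (rule ccontr)
  assume "\<not> X a t < X b t"
  moreover have "continuous_on {0..<1} (X c)" for c
    by (rule DERIV_continuous_on[OF X_deriv])
  then have "continuous_on {0..t} (\<lambda>s. X b s - X a s)"
    using t by (intro continuous_intros) (auto intro: continuous_on_subset[of "{0..<1}"])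
  ultimately obtain s where "0 \<le> s" "s \<le> t" "X b s - X a s = 0"
    using IVT2'[of "\<lambda>s. X b s - X a s" t 0 0] ab t by auto
  then show False
    using inj_X[of s b a] t ab by auto
qed

lemma X_less_iff: "t \<in> {0..<1} \<Longrightarrow> X a t < X b t \<longleftrightarrow> a < b"
  using X_less by (metis not_less_iff_gr_or_eq)

lemma X_image_interval:
  assumes t: "t \<in> {0..<1}"
  shows "(\<lambda>c. X c t) ` {a<..<b} = {X a t<..<X b t}"
proof (intro equalityI subsetI)
  fix y assume "y \<in> {X a t<..<X b t}"
  moreover obtain c where "y = X c t"
    using surj_X[OF t] by blast
  ultimately show "y \<in> (\<lambda>c. X c t) ` {a<..<b}"
    using X_less_iff[OF t] by auto
qed (use X_less[OF t] in auto)

lemma \<rho>_eq: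
  assumes t: "t \<in> {0..<1}"
  shows "\<rho> y t = indicator ((\<lambda>a. X a t) ` \<Omega>\<^sub>0) y / (1 - t)"
proof -
  obtain a where a: "y = X a t"
    using surj_X[OF t] by blast
  have "y \<in> (\<lambda>a. X a t) ` \<Omega>\<^sub>0 \<longleftrightarrow> a \<in> \<Omega>\<^sub>0"
    using inj_X[OF t] a by auto
  then show ?thesis
    using solution t a
    by (cases "a \<in> \<Omega>\<^sub>0") (auto simp: aggregation_solution_def)
qed

section \<open>Conservation of mass along the flow\<close>

text \<open>The length \<open>L t\<close> of the image of \<open>(a, b)\<close> is governed by the mass between its endpoints, which
  is \<open>L t / (1 - t)\<close> because the image lies in the patch; hence \<open>L' = - L / (1 - t)\<close>,
  and \<open>L t / (1 - t)\<close> is constant.\<close>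

lemma X_contraction:
  assumes t: "t \<in> {0..<1}" and ab: "a \<le> b" and sub: "{a<..<b} \<subseteq> \<Omega>\<^sub>0"
  shows "X b t - X a t = (1 - t) * (b - a)"
proof (cases "a = b")
  case False
  with ab have less: "a < b"
    by simp
  have velocity: "v (X b s) s - v (X a s) s = - ((X b s - X a s) / (1 - s))"
    if s: "s \<in> {0..<1}" for s
  proof -
    have "v (X b s) s - v (X a s) s = - (LINT y:{X a s<..<X b s}|lborel. \<rho> y s)"
      using aggregation_velocity_diff[of \<rho> s, OF integrable_\<rho>[OF s] X_less[OF s less]]
      by (simp add: v_eq[OF s])
    also have "(LINT y:{X a s<..<X b s}|lborel. \<rho> y s)
        = (LINT y:{X a s<..<X b s}|lborel. 1 / (1 - s))"
    proof (rule set_lebesgue_integral_cong)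
      have "{X a s<..<X b s} \<subseteq> (\<lambda>c. X c s) ` \<Omega>\<^sub>0"
        using sub X_image_interval[OF s] by blast
      then show "\<forall>y. y \<in> {X a s<..<X b s} \<longrightarrow> \<rho> y s = 1 / (1 - s)"
        by (auto simp: \<rho>_eq[OF s])
    qed simp
    also have "\<dots> = (X b s - X a s) / (1 - s)"
      using X_less[OF s less]
      by (simp add: set_lebesgue_integral_def)
    finally show ?thesis .
  qed
  define g where "g s = (X b s - X a s) / (1 - s)" for s
  have "(g has_real_derivative 0) (at s within {0..<1})" if s: "s \<in> {0..<1}" for s
  proof -
    have "(g has_real_derivative
        ((v (X b s) s - v (X a s) s) * (1 - s) - (X b s - X a s) * (0 - 1)) / ((1 - s) * (1 - s)))
        (at s within {0..<1})"
      unfolding g_def using s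
      by (intro DERIV_divide DERIV_diff X_deriv DERIV_const DERIV_ident) auto
    then show ?thesis
      using s by (simp add: velocity[OF s])
  qed
  then have "\<exists>c. \<forall>s\<in>{0..<1}. g s = c"
    by (intro has_field_derivative_zero_constant) auto
  then have "g t = g 0"
    using t by fastforce
  then show ?thesis
    using t by (simp add: g_def field_simps)
qed simp

definition patch :: "real measure" where
  "patch = density lborel (indicator \<Omega>\<^sub>0)"

lemma sets_patch [simp, measurable_cong]: "sets patch = sets borel"
  by (simp add: patch_def)

lemma space_patch [simp]: "space patch = UNIV"
  by (simp add: patch_def)

lemma open_\<Omega>\<^sub>0: "open \<Omega>\<^sub>0"
  by (auto simp: \<Omega>\<^sub>0_eq)

lemma measurable_\<Omega>\<^sub>0 [measurable, simp]: "\<Omega>\<^sub>0 \<in> sets borel"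
  using open_\<Omega>\<^sub>0 by simp

lemma emeasure_patch: "A \<in> sets borel \<Longrightarrow> emeasure patch A = emeasure lborel (\<Omega>\<^sub>0 \<inter> A)"
  by (simp add: patch_def emeasure_restricted)

lemma finite_measure_patch: "finite_measure patch"
  using emeasure_bounded_finite[OF bounded_\<Omega>\<^sub>0]
  by (intro finite_measureI) (simp add: emeasure_patch)

lemma AE_patch: "AE a in patch. a \<in> \<Omega>\<^sub>0"
  unfolding patch_def by (subst AE_density) (auto simp: indicator_def)

text \<open>On each component the flow scales lengths by \<open>1 - t\<close>, the inverse of the density, so the
  part of the patch starting to the right of \<open>c\<close> keeps its mass.\<close>

lemma emeasure_X_image_ray:
  assumes t: "t \<in> {0..<1}"
  shows "(\<lambda>a. X a t) ` (\<Omega>\<^sub>0 \<inter> {c<..}) \<in> sets borel"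
    and "emeasure lborel ((\<lambda>a. X a t) ` (\<Omega>\<^sub>0 \<inter> {c<..}))
      = ennreal (1 - t) * emeasure lborel (\<Omega>\<^sub>0 \<inter> {c<..})"
proof -
  define J where "J i = {max (\<alpha> i) c<..<\<beta> i}" for i
  have J: "\<Omega>\<^sub>0 \<inter> {c<..} = (\<Union>i. J i)"
    by (auto simp: \<Omega>\<^sub>0_eq J_def)
  have disj: "disjoint_family J"
    by (rule disjoint_family_subset[OF disjoint]) (auto simp: J_def)
  have disj': "disjoint_family (\<lambda>i. (\<lambda>a. X a t) ` J i)"
    using disj unfolding disjoint_family_on_def by (simp flip: image_Int[OF inj_onI[OF inj_X[OF t]]])
  have image: "(\<lambda>a. X a t) ` J i = {X (max (\<alpha> i) c) t<..<X (\<beta> i) t}" for i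
    unfolding J_def by (rule X_image_interval[OF t])
  have length: "emeasure lborel ((\<lambda>a. X a t) ` J i) = ennreal (1 - t) * emeasure lborel (J i)" for i
  proof (cases "max (\<alpha> i) c \<le> \<beta> i")
    case True
    moreover have "J i \<subseteq> \<Omega>\<^sub>0"
      by (auto simp: \<Omega>\<^sub>0_eq J_def)
    ultimately have scale:
      "X (\<beta> i) t - X (max (\<alpha> i) c) t = (1 - t) * (\<beta> i - max (\<alpha> i) c)"
      unfolding J_def by (intro X_contraction[OF t]) auto
    moreover have "0 \<le> (1 - t) * (\<beta> i - max (\<alpha> i) c)"
      using True t by (intro mult_nonneg_nonneg) auto
    ultimately have "X (max (\<alpha> i) c) t \<le> X (\<beta> i) t"
      by linarith
    then show ?thesis
      using True t scale unfolding image by (simp add: J_def ennreal_mult)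
  next
    case False
    then have "J i = {}"
      by (auto simp: J_def)
    then show ?thesis
      by simp
  qed
  show "(\<lambda>a. X a t) ` (\<Omega>\<^sub>0 \<inter> {c<..}) \<in> sets borel"
    unfolding J image_UN image by auto
  have "emeasure lborel ((\<lambda>a. X a t) ` (\<Omega>\<^sub>0 \<inter> {c<..}))
      = (\<Sum>i. emeasure lborel ((\<lambda>a. X a t) ` J i))"
    unfolding J image_UN by (rule suminf_emeasure[symmetric]) (use disj' in \<open>auto simp: image\<close>)
  also have "\<dots> = ennreal (1 - t) * (\<Sum>i. emeasure lborel (J i))"
    by (simp add: length)
  also have "(\<Sum>i. emeasure lborel (J i)) = emeasure lborel (\<Omega>\<^sub>0 \<inter> {c<..})"
    unfolding J by (rule suminf_emeasure[OF _ disj]) (auto simp: J_def)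
  finally show "emeasure lborel ((\<lambda>a. X a t) ` (\<Omega>\<^sub>0 \<inter> {c<..}))
      = ennreal (1 - t) * emeasure lborel (\<Omega>\<^sub>0 \<inter> {c<..})" .
qed

lemma density_\<rho>_eq_distr:
  assumes t: "t \<in> {0..<1}"
  shows "density lborel (\<lambda>y. ennreal (\<rho> y t)) = distr patch borel (\<lambda>a. X a t)" (is "?M = ?N")
proof -
  have X_meas: "(\<lambda>a. X a t) \<in> patch \<rightarrow>\<^sub>M borel"
    using measurable_X[OF t] by simp
  have \<rho>_meas: "(\<lambda>y. \<rho> y t) \<in> borel_measurable borel"
    using borel_measurable_integrable[OF integrable_\<rho>[OF t]] by simp
  have ray: "emeasure ?M {X c t<..} = emeasure ?N {X c t<..}" for c
  proof -
    let ?S = "(\<lambda>a. X a t) ` (\<Omega>\<^sub>0 \<inter> {c<..})"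
    have ind: "ennreal (\<rho> y t) * indicator {X c t<..} y = ennreal (1 / (1 - t)) * indicator ?S y" for y
    proof -
      obtain a where "y = X a t"
        using surj_X[OF t] by blast
      moreover have "X a t \<in> (\<lambda>a. X a t) ` A \<longleftrightarrow> a \<in> A" for A
        using inj_X[OF t] by blast
      ultimately show ?thesis
        using t by (simp add: \<rho>_eq[OF t] X_less_iff[OF t] indicator_def)
    qed
    have "emeasure ?M {X c t<..} = (\<integral>\<^sup>+ y. ennreal (1 / (1 - t)) * indicator ?S y \<partial>lborel)"
      using \<rho>_meas by (simp add: emeasure_density ind)
    also have "\<dots> = ennreal (1 / (1 - t)) * emeasure lborel ?S"
      using emeasure_X_image_ray(1)[OF t] by (subst nn_integral_cmult_indicator) auto
    also have "\<dots> = ennreal (1 / (1 - t)) * ennreal (1 - t) * emeasure lborel (\<Omega>\<^sub>0 \<inter> {c<..})"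
      by (simp only: emeasure_X_image_ray(2)[OF t] mult.assoc)
    also have "ennreal (1 / (1 - t)) * ennreal (1 - t) = 1"
      using t by (simp flip: ennreal_mult)
    also have "1 * emeasure lborel (\<Omega>\<^sub>0 \<inter> {c<..}) = emeasure patch ((\<lambda>a. X a t) -` {X c t<..})"
    proof -
      have "(\<lambda>a. X a t) -` {X c t<..} = {c<..}"
        using X_less_iff[OF t] by auto
      then show ?thesis
        by (simp add: emeasure_patch)
    qed
    also have "\<dots> = emeasure ?N {X c t<..}"
      using X_meas by (simp add: emeasure_distr)
    finally show ?thesis .
  qed
  show ?thesis
  proof (rule measure_eqI_lessThan)
    fix y
    show "emeasure ?M {y<..} = emeasure ?N {y<..}"
      using ray surj_X[OF t] by metis
    moreover have "emeasure ?N {y<..} < \<infinity>"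
      using X_meas finite_measure.emeasure_finite[OF finite_measure_patch]
      by (simp add: emeasure_distr less_top)
    ultimately show "emeasure ?M {y<..} < \<infinity>"
      by simp
  qed simp_all
qed

section \<open>Straight-line motion and collapse of the components\<close>

text \<open>The velocity of a particle only depends on how the mass is split between its two sides.
  The flow preserves mass and the order of the particles, hence this splitting, so the velocity is
  constant in time.\<close>

lemma velocity_along_path:
  assumes t: "t \<in> {0..<1}"
  shows "v (X a t) t = - (LINT b|patch. newton_deriv (a - b))"
proof -
  have \<rho>_meas: "(\<lambda>y. \<rho> y t) \<in> borel_measurable lborel"
    by (rule borel_measurable_integrable[OF integrable_\<rho>[OF t]])
  have N_meas: "newton_deriv \<in> borel_measurable borel"
    unfolding newton_deriv_def by measurable
  have "(LINT y|lborel. newton_deriv (X a t - y) * \<rho> y t)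
      = (LINT y|density lborel (\<lambda>y. ennreal (\<rho> y t)). newton_deriv (X a t - y))"
    using t \<rho>_meas N_meas
    by (subst integral_density) (auto simp: \<rho>_eq[OF t] mult.commute)
  also have "\<dots> = (LINT b|patch. newton_deriv (X a t - X b t))"
    unfolding density_\<rho>_eq_distr[OF t] using measurable_X[OF t] N_meas
    by (subst integral_distr) auto
  also have "\<dots> = (LINT b|patch. newton_deriv (a - b))"
    by (rule Bochner_Integration.integral_cong)
       (auto simp: newton_deriv_def sgn_if X_less_iff[OF t] dest: inj_X[OF t])
  finally show ?thesis
    by (simp add: v_eq[OF t] aggregation_velocity_def)
qed

definition extended_path :: "real \<Rightarrow> real \<Rightarrow> real" where
  "extended_path a t = a + t * v a 0"

lemma X_eq_path:
  assumes t: "t \<in> {0..<1}"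
  shows "X a t = extended_path a t"
proof -
  have "((\<lambda>s. X a s - s * v a 0) has_real_derivative 0) (at s within {0..<1})"
    if s: "s \<in> {0..<1}" for s
  proof -
    have "v (X a s) s = v a 0"
      using velocity_along_path[OF s, of a] velocity_along_path[of 0 a] by simp
    then show ?thesis
      using X_deriv[OF s, of a] by (auto intro!: derivative_eq_intros)
  qed
  then have "\<exists>c. \<forall>s\<in>{0..<1}. X a s - s * v a 0 = c"
    by (intro has_field_derivative_zero_constant) auto
  then obtain c where c: "\<forall>s\<in>{0..<1}. X a s - s * v a 0 = c" ..
  have "X a t - t * v a 0 = X a 0 - 0 * v a 0"
    using t by (intro trans[OF bspec[OF c] bspec[OF c, symmetric]]) auto
  then show ?thesis
    by (simp add: extended_path_def)
qed

text \<open>The initial velocity can be read off the homeomorphism at any single intermediate time.\<close>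

lemma continuous_initial_velocity: "continuous_on UNIV (\<lambda>a. v a 0)"
proof -
  have "v a 0 = 2 * (X a (1/2) - a)" for a
    by (simp add: X_eq_path extended_path_def)
  then show ?thesis
    using continuous_X[of "1/2"] by (auto intro!: continuous_intros)
qed

lemma continuous_path: "continuous_on UNIV (\<lambda>(a, t). extended_path a t)"
  unfolding extended_path_def case_prod_beta
  by (intro continuous_intros continuous_on_compose2[OF continuous_initial_velocity]) auto

lemma measurable_path: "(\<lambda>a. extended_path a t) \<in> borel_measurable borel"
  unfolding extended_path_def
  using continuous_initial_velocity
  by (intro borel_measurable_continuous_onI continuous_intros)

lemma tendsto_path: "(X a \<longlongrightarrow> extended_path a 1) (at_left 1)"
proof -
  have "(extended_path a \<longlongrightarrow> extended_path a 1) (at_left 1)"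
    unfolding extended_path_def by (intro tendsto_intros)
  moreover have "\<forall>\<^sub>F t in at_left 1. extended_path a t = X a t"
    using eventually_before_blowup
    by (rule eventually_mono) (auto simp: X_eq_path)
  ultimately show ?thesis
    by (rule Lim_transform_eventually)
qed

text \<open>The distance of two particles of one component is affine in \<open>t\<close> and equals
  \<open>(1 - t) \<cdot> (b - a)\<close> for \<open>t < 1\<close>, so it vanishes at \<open>t = 1\<close>. An affine function is determined by
  its values at \<open>0\<close> and at \<open>1/2\<close>.\<close>

lemma path_1_eq:
  assumes "a \<in> {\<alpha> i<..<\<beta> i}" "b \<in> {\<alpha> i<..<\<beta> i}"
  shows "extended_path a 1 = extended_path b 1"
  using assms
proof (induction a b rule: linorder_wlog)
  case (le a b)
  then have "{a<..<b} \<subseteq> \<Omega>\<^sub>0"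
    unfolding \<Omega>\<^sub>0_eq by (intro SUP_upper2[of i]) auto
  with le have "X b (1/2) - X a (1/2) = (1/2) * (b - a)"
    by (subst X_contraction) auto
  then show ?case
    by (simp add: X_eq_path extended_path_def field_simps)
qed simp

definition collapse_point :: "nat \<Rightarrow> real" where
  "collapse_point i = extended_path ((\<alpha> i + \<beta> i) / 2) 1"

lemma path_1_eq_collapse_point: "a \<in> {\<alpha> i<..<\<beta> i} \<Longrightarrow> extended_path a 1 = collapse_point i"
  unfolding collapse_point_def using endpoints[of i] by (intro path_1_eq) auto

lemma tendsto_collapse_point: "a \<in> {\<alpha> i<..<\<beta> i} \<Longrightarrow> (X a \<longlongrightarrow> collapse_point i) (at_left 1)"
  using tendsto_path[of a] by (simp only: path_1_eq_collapse_point)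

lemma skeleton_eq: "skeleton 1 X \<Omega>\<^sub>0 = (\<Union>i. {collapse_point i})"
proof (intro equalityI subsetI)
  fix x assume "x \<in> skeleton 1 X \<Omega>\<^sub>0"
  then obtain a i where "a \<in> {\<alpha> i<..<\<beta> i}" "(X a \<longlongrightarrow> x) (at_left 1)"
    by (auto simp: skeleton_def \<Omega>\<^sub>0_eq)
  then have "x = collapse_point i"
    using tendsto_collapse_point tendsto_unique[of "at_left (1::real)"] by fastforce
  then show "x \<in> (\<Union>i. {collapse_point i})"
    by blast
next
  fix x assume "x \<in> (\<Union>i. {collapse_point i})"
  then obtain i where i: "x = collapse_point i"
    by auto
  have mid: "(\<alpha> i + \<beta> i) / 2 \<in> {\<alpha> i<..<\<beta> i}"
    using endpoints[of i] by simp
  then have "(\<alpha> i + \<beta> i) / 2 \<in> \<Omega>\<^sub>0"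
    unfolding \<Omega>\<^sub>0_eq by blast
  then show "x \<in> skeleton 1 X \<Omega>\<^sub>0"
    using tendsto_collapse_point[OF mid] i unfolding skeleton_def by blast
qed

section \<open>Weak convergence\<close>

lemma dirac_sum_eq_distr:
  "dirac_sum (\<lambda>i. emeasure lborel {\<alpha> i<..<\<beta> i}) collapse_point
    = distr patch borel (\<lambda>a. extended_path a 1)"
proof (rule measure_eqI)
  fix A assume "A \<in> sets (dirac_sum (\<lambda>i. emeasure lborel {\<alpha> i<..<\<beta> i}) collapse_point)"
  then have A: "A \<in> sets borel"
    by simp
  let ?P = "(\<lambda>a. extended_path a 1) -` A"
  have P: "?P \<in> sets borel"
    using measurable_sets_borel[OF measurable_path A] .
  have part: "{\<alpha> i<..<\<beta> i} \<inter> ?P = (if collapse_point i \<in> A then {\<alpha> i<..<\<beta> i} else {})" for i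
    using path_1_eq_collapse_point[of _ i] by auto
  have "emeasure (distr patch borel (\<lambda>a. extended_path a 1)) A = emeasure lborel (\<Omega>\<^sub>0 \<inter> ?P)"
    using A P measurable_path by (simp add: emeasure_distr emeasure_patch)
  also have "\<Omega>\<^sub>0 \<inter> ?P = (\<Union>i. {\<alpha> i<..<\<beta> i} \<inter> ?P)"
    by (auto simp: \<Omega>\<^sub>0_eq)
  also have "emeasure lborel \<dots> = (\<Sum>i. emeasure lborel ({\<alpha> i<..<\<beta> i} \<inter> ?P))"
    using P by (intro suminf_emeasure[symmetric] disjoint_family_subset[OF disjoint]) auto
  also have "\<dots> = emeasure (dirac_sum (\<lambda>i. emeasure lborel {\<alpha> i<..<\<beta> i}) collapse_point) A"
    unfolding part emeasure_dirac_sum[OF A]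
    using A by (intro suminf_cong) (simp add: indicator_def)
  finally show "emeasure (dirac_sum (\<lambda>i. emeasure lborel {\<alpha> i<..<\<beta> i}) collapse_point) A
      = emeasure (distr patch borel (\<lambda>a. extended_path a 1)) A" ..
qed simp

text \<open>All paths of the patch stay in one compact set up to the blow-up time; this is what
  allows unbounded test functions.\<close>

lemma bounded_on_paths:
  fixes f :: "real \<Rightarrow> real"
  assumes f: "continuous_on UNIV f"
  obtains B where "\<And>a t. a \<in> \<Omega>\<^sub>0 \<Longrightarrow> t \<in> {0..1} \<Longrightarrow> \<bar>f (extended_path a t)\<bar> \<le> B"
proof -
  have "compact ((\<lambda>(a, t). f (extended_path a t)) ` (closure \<Omega>\<^sub>0 \<times> {0..1}))"
    using bounded_\<Omega>\<^sub>0 continuous_on_compose2[OF f continuous_path]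
    by (intro compact_continuous_image compact_Times)
       (auto simp: case_prod_beta' intro: continuous_on_subset)
  then obtain B where "\<forall>y\<in>(\<lambda>(a, t). f (extended_path a t)) ` (closure \<Omega>\<^sub>0 \<times> {0..1}). norm y \<le> B"
    using compact_imp_bounded bounded_iff by metis
  then show thesis
    using closure_subset[of \<Omega>\<^sub>0] by (intro that[of B]) fastforce
qed

lemma integrable_path:
  fixes f :: "real \<Rightarrow> real"
  assumes f: "continuous_on UNIV f" and t: "t \<in> {0..1}"
  shows "integrable patch (\<lambda>a. f (extended_path a t))"
proof -
  obtain B where B: "\<And>a t. a \<in> \<Omega>\<^sub>0 \<Longrightarrow> t \<in> {0..1} \<Longrightarrow> \<bar>f (extended_path a t)\<bar> \<le> B"
    using bounded_on_paths[OF f] by blast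
  show ?thesis
  proof (rule finite_measure.integrable_const_bound[OF finite_measure_patch])
    show "AE a in patch. norm (f (extended_path a t)) \<le> B"
      using AE_patch by eventually_elim (use B t in auto)
    show "(\<lambda>a. f (extended_path a t)) \<in> borel_measurable patch"
      using measurable_path borel_measurable_continuous_onI[OF f] by simp
  qed
qed

text \<open>After transport to the initial labels the measure is fixed and only the integrand
  \<open>a \<mapsto> f (extended_path a t)\<close> moves, so the limit is one of dominated convergence.\<close>

lemma weakly_converges_patch:
  "weakly_converges (\<lambda>t. distr patch borel (\<lambda>a. extended_path a t))
    (distr patch borel (\<lambda>a. extended_path a 1)) (at_left 1)"
  unfolding weakly_converges_def
proof (intro allI impI conjI)
  fix f :: "real \<Rightarrow> real" assume f: "continuous_on UNIV f"
  have f_meas: "f \<in> borel_measurable borel"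
    by (rule borel_measurable_continuous_onI[OF f])
  have integrable: "integrable (distr patch borel (\<lambda>a. extended_path a t)) f" if "t \<in> {0..1}" for t
    using integrable_path[OF f that] f_meas measurable_path by (subst integrable_distr_eq) auto
  show "integrable (distr patch borel (\<lambda>a. extended_path a 1)) f"
    by (rule integrable) simp
  show "\<forall>\<^sub>F t in at_left 1. integrable (distr patch borel (\<lambda>a. extended_path a t)) f"
    using eventually_before_blowup
    by (rule eventually_mono) (auto intro: integrable)
  have integral: "(LINT x|distr patch borel (\<lambda>a. extended_path a t). f x)
      = (LINT a|patch. f (extended_path a t))" for t
    using f_meas measurable_path by (subst integral_distr) auto
  obtain B where B: "\<And>a t. a \<in> \<Omega>\<^sub>0 \<Longrightarrow> t \<in> {0..1} \<Longrightarrow> \<bar>f (extended_path a t)\<bar> \<le> B"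
    using bounded_on_paths[OF f] by blast
  show "((\<lambda>t. LINT x|distr patch borel (\<lambda>a. extended_path a t). f x)
      \<longlongrightarrow> (LINT x|distr patch borel (\<lambda>a. extended_path a 1). f x)) (at_left 1)"
    unfolding integral
  proof (rule tendsto_at_left_sequentially[of 0])
    fix S :: "nat \<Rightarrow> real"
    assume S: "\<And>n. S n < 1" "\<And>n. 0 < S n" "S \<longlonglongrightarrow> 1"
    show "(\<lambda>n. LINT a|patch. f (extended_path a (S n))) \<longlonglongrightarrow> (LINT a|patch. f (extended_path a 1))"
    proof (rule integral_dominated_convergence[where w = "\<lambda>_. B"])
      show "AE a in patch. (\<lambda>n. f (extended_path a (S n))) \<longlonglongrightarrow> f (extended_path a 1)"
      proof (rule AE_I2)
        fix a
        have "(\<lambda>n. extended_path a (S n)) \<longlonglongrightarrow> extended_path a 1"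
          unfolding extended_path_def by (intro tendsto_intros S)
        moreover have "isCont f (extended_path a 1)"
          using f by (simp add: continuous_on_eq_continuous_at)
        ultimately show "(\<lambda>n. f (extended_path a (S n))) \<longlonglongrightarrow> f (extended_path a 1)"
          by (rule isCont_tendsto_compose[rotated])
      qed
      show "AE a in patch. norm (f (extended_path a (S n))) \<le> B" for n
        using AE_patch by eventually_elim (use B[of _ "S n"] S(1,2)[of n] in simp)
      show "integrable patch (\<lambda>_. B)"
        by (rule finite_measure.integrable_const[OF finite_measure_patch])
    qed (use f_meas measurable_path in simp_all)
  qed simp
qed

lemma weakly_converges_\<rho>:
  "weakly_converges (\<lambda>t. density lborel (\<lambda>y. ennreal (\<rho> y t)))
    (dirac_sum (\<lambda>i. emeasure lborel {\<alpha> i<..<\<beta> i}) collapse_point) (at_left 1)"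
proof -
  have eq: "\<forall>\<^sub>F t in at_left 1. density lborel (\<lambda>y. ennreal (\<rho> y t))
      = distr patch borel (\<lambda>a. extended_path a t)"
    using eventually_before_blowup
    by (rule eventually_mono) (auto simp: density_\<rho>_eq_distr X_eq_path)
  show ?thesis
    unfolding weakly_converges_def dirac_sum_eq_distr
  proof (intro allI impI)
    fix f :: "real \<Rightarrow> real" assume f: "continuous_on UNIV f"
    let ?M = "\<lambda>t. density lborel (\<lambda>y. ennreal (\<rho> y t))"
    let ?N = "\<lambda>t. distr patch borel (\<lambda>a. extended_path a t)"
    have lim: "(\<forall>\<^sub>F t in at_left 1. integrable (?N t) f) \<and> integrable (?N 1) f \<and>
        ((\<lambda>t. LINT x|?N t. f x) \<longlongrightarrow> (LINT x|?N 1. f x)) (at_left 1)"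
      using weakly_converges_patch f unfolding weakly_converges_def by (elim allE[of _ f] impE)
    show "(\<forall>\<^sub>F t in at_left 1. integrable (?M t) f) \<and> integrable (?N 1) f \<and>
        ((\<lambda>t. LINT x|?M t. f x) \<longlongrightarrow> (LINT x|?N 1. f x)) (at_left 1)"
    proof (intro conjI)
      show "\<forall>\<^sub>F t in at_left 1. integrable (?M t) f"
        using eq conjunct1[OF lim] by eventually_elim simp
      have "\<forall>\<^sub>F t in at_left 1. (LINT x|?N t. f x) = (LINT x|?M t. f x)"
        using eq by eventually_elim simp
      then show "((\<lambda>t. LINT x|?M t. f x) \<longlongrightarrow> (LINT x|?N 1. f x)) (at_left 1)"
        by (rule Lim_transform_eventually[OF conjunct2[OF conjunct2[OF lim]]])
    qed (rule conjunct1[OF conjunct2[OF lim]])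
  qed
qed

end

theorem theorem2p1:
  fixes \<alpha> \<beta> :: "nat \<Rightarrow> real"
    and \<Omega>\<^sub>0 :: "real set"
    and \<rho> v X :: "real \<Rightarrow> real \<Rightarrow> real"
  assumes "\<And>i. \<alpha> i < \<beta> i"
    and "disjoint_family (\<lambda>i. {\<alpha> i<..<\<beta> i})"
    and "\<Omega>\<^sub>0 = (\<Union>i. {\<alpha> i<..<\<beta> i})"
    and "bounded \<Omega>\<^sub>0"
    and "aggregation_solution 1 (indicator \<Omega>\<^sub>0) \<rho> v X"
  shows "\<exists>x :: nat \<Rightarrow> real.
      (\<forall>i. \<forall>a\<in>{\<alpha> i<..<\<beta> i}. (X a \<longlongrightarrow> x i) (at_left 1)) \<and>
      skeleton 1 X \<Omega>\<^sub>0 = (\<Union>i. {x i}) \<and>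
      weakly_converges (\<lambda>t. density lborel (\<lambda>y. ennreal (\<rho> y t)))
        (dirac_sum (\<lambda>i. emeasure lborel {\<alpha> i<..<\<beta> i}) x) (at_left 1)"
proof -
  interpret patch_solution \<alpha> \<beta> \<Omega>\<^sub>0 \<rho> v X
    using assms by unfold_locales
  show ?thesis
    using tendsto_collapse_point skeleton_eq weakly_converges_\<rho>
    by (intro exI[of _ collapse_point] conjI allI ballI)
qed

end
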